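(* Let $g\geqslant1$ and let $(w_n(t))_{n\in\mathbb{Z}}$ be the sequence of meromorphic functions on $\mathbb{C}$ obtained by applying all (positive and negative) iterates of the Volterra map $\mathcal{V}_g$ to the solution, with generic initial condition in $M_g$, of the vector field $\mathrm{X}_1$. Then $(w_n(t))_{n\in\mathbb{Z}}$ is a solution of the infinite Volterra lattice $$\frac{\mathrm{d}w_n}{\mathrm{d}t}=w_n(w_{n+1}-w_{n-1}),\qquad n\in\mathbb{Z}.$$
   Context: $M_g$ is the affine space of triplets $(\mathcal{P},\mathcal{Q},\mathcal{R})$ of complex polynomials $\mathcal{P}=1+\sum_{i=1}^gp_ix^i$, $\mathcal{Q}=2+\sum_{i=1}^gq_ix^i$, $\mathcal{R}=\sum_{i=1}^{g+1}r_ix^i$. The vector field $\mathrm{X}_1$ on $M_g$ is $\dot{\mathcal{P}}(x)=\frac{\mathcal{R}(x)}{x}-\frac{r_1}{2}\mathcal{Q}(x)$, $\dot{\mathcal{Q}}(x)=\frac{2p_1-q_1}{2}\mathcal{Q}(x)-\frac{2\mathcal{P}(x)-\mathcal{Q}(x)}{x}$, $\dot{\mathcal{R}}(x)=r_1\mathcal{P}(x)+\frac{q_1-2p_1}{2}\mathcal{R}(x)-\frac{\mathcal{R}(x)}{x}$. It equals $\frac12\{\cdot,H_{g+2}\}$, where $\mathcal{P}^2+\mathcal{Q}\mathcal{R}=1+\sum_{i=1}^{2g+1}H_ix^i$ and $\{\cdot,\cdot\}$ is the Poisson bracket on $M_g$ given by $\{\mathcal{P}(x),\mathcal{P}(y)\}=\{\mathcal{Q}(x),\mathcal{Q}(y)\}=0$,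 $\{\mathcal{R}(x),\mathcal{R}(y)\}=\phi(y)\mathcal{R}(x)-\phi(x)\mathcal{R}(y)$, $\{\mathcal{P}(x),\mathcal{Q}(y)\}=\frac{\phi(x)y\mathcal{Q}(y)-\phi(y)x\mathcal{Q}(x)}{x-y}$, $\{\mathcal{P}(x),\mathcal{R}(y)\}=-y\frac{\phi(x)\mathcal{R}(y)-\phi(y)\mathcal{R}(x)}{x-y}$, $\{\mathcal{Q}(x),\mathcal{R}(y)\}=2y\frac{\phi(x)\mathcal{P}(y)-\phi(y)\mathcal{P}(x)}{x-y}-\phi(y)\mathcal{Q}(x)$ with $\phi(x)=x^{g+1}$. For generic initial conditions its integral curves extend to meromorphic functions of $t\in\mathbb{C}$. The Volterra map $\mathcal{V}_g$ is the birational automorphism of $M_g$ sending $(\mathcal{P},\mathcal{Q},\mathcal{R})$ to $\Big(\mathcal{Q}-\mathcal{P},\ \frac{2\mathcal{P}-\mathcal{Q}+\mathcal{R}}{-wx},\ -wx\mathcal{Q}\Big)$, $w=-\frac12(2p_1-q_1+r_1)$. Its inverse is also rational, and $\mathcal{V}_g$ commutes with the flow of $\mathrm{X}_1$. Given a meromorphic integral curve $t\mapsto(\mathcal{P}_0(x;t),\mathcal{Q}_0(x;t),\mathcal{R}_0(x;t))$ of $\mathrm{X}_1$ with generic initial condition (so that all iterates exist), put $(\mathcal{P}_n,\mathcal{Q}_n,\mathcal{R}_n)=\mathcal{V}_g^n(\mathcal{P}_0,\mathcal{Q}_0,\mathcal{R}_0)$ for $n\in\mathbb{Z}$, and $w_n(t)=-\frac12r_{n,1}(t)$,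 where $r_{n,1}(t)$ is the coefficient of $x$ in $\mathcal{R}_n(x;t)$ (equivalently, $w_{n+1}=-\frac12(2p_{n,1}-q_{n,1}+r_{n,1})$). *)

theory Defs
  imports "HOL-Complex_Analysis.Complex_Analysis"
begin

type_synonym triplet = "complex poly \<times> complex poly \<times> complex poly"

definition pcoef :: "triplet \<Rightarrow> nat \<Rightarrow> complex" where
  "pcoef m i = coeff (fst m) i"

definition qcoef :: "triplet \<Rightarrow> nat \<Rightarrow> complex" where
  "qcoef m i = coeff (fst (snd m)) i"

definition rcoef :: "triplet \<Rightarrow> nat \<Rightarrow> complex" where
  "rcoef m i = coeff (snd (snd m)) i"

definition Mspace :: "nat \<Rightarrow> triplet set" where
  "Mspace g = {(P, Q, R). degree P \<le> g \<and> coeff P 0 = 1 \<and>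
                     degree Q \<le> g \<and> coeff Q 0 = 2 \<and>
                     degree R \<le> g + 1 \<and> coeff R 0 = 0}"


section \<open>The vector field \<open>X\<^sub>1\<close> and its integral curves\<close>

text \<open>The polynomial \<open>[:0, 1:]\<close> is \<open>x\<close>. On \<open>Mspace g\<close> the polynomials \<open>R\<close> and \<open>2 P - Q\<close> have no constant
  term, so that all divisions by \<open>x\<close> are exact.\<close>

fun X1 :: "triplet \<Rightarrow> triplet" where
  "X1 (P, Q, R) =
     (let p1 = coeff P 1; q1 = coeff Q 1; r1 = coeff R 1 in
      (R div [:0, 1:] - smult (r1 / 2) Q,
       smult ((2 * p1 - q1) / 2) Q - (smult 2 P - Q) div [:0, 1:],
       smult r1 P + smult ((q1 - 2 * p1) / 2) R - R div [:0, 1:]))"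

text \<open>A meromorphic curve in \<open>Mspace g\<close>: the coefficients are meromorphic functions on the whole
  complex plane. As everywhere in the library, the value of a meromorphic function at a pole is an
  irrelevant dummy value, and identities between meromorphic functions are required to hold
  outside a set without accumulation points, i.e. eventually in the filter \<open>cosparse UNIV\<close>.\<close>

definition meromorphic_curve :: "nat \<Rightarrow> (complex \<Rightarrow> triplet) \<Rightarrow> bool" where
  "meromorphic_curve g c \<longleftrightarrow>
     (\<forall>t. c t \<in> Mspace g) \<and>
     (\<forall>i. (\<lambda>t. pcoef (c t) i) meromorphic_on UNIV \<and>
          (\<lambda>t. qcoef (c t) i) meromorphic_on UNIV \<and>
          (\<lambda>t. rcoef (c t) i) meromorphic_on UNIV)"

definition has_triplet_derivative ::
    "(complex \<Rightarrow> triplet) \<Rightarrow> triplet \<Rightarrow> complex \<Rightarrow> bool" where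
  "has_triplet_derivative c m t \<longleftrightarrow>
     (\<forall>i. ((\<lambda>s. pcoef (c s) i) has_field_derivative pcoef m i) (at t) \<and>
          ((\<lambda>s. qcoef (c s) i) has_field_derivative qcoef m i) (at t) \<and>
          ((\<lambda>s. rcoef (c s) i) has_field_derivative rcoef m i) (at t))"

definition meromorphic_integral_curve :: "nat \<Rightarrow> (complex \<Rightarrow> triplet) \<Rightarrow> bool" where
  "meromorphic_integral_curve g c \<longleftrightarrow>
     meromorphic_curve g c \<and>
     (\<forall>\<^sub>\<approx>t\<in>UNIV. has_triplet_derivative c (X1 (c t)) t)"

definition has_initial_condition :: "(complex \<Rightarrow> triplet) \<Rightarrow> triplet \<Rightarrow> bool" where
  "has_initial_condition c m \<longleftrightarrow>
     c 0 = m \<and>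
     (\<forall>i. (\<lambda>t. pcoef (c t) i) analytic_on {0} \<and>
          (\<lambda>t. qcoef (c t) i) analytic_on {0} \<and>
          (\<lambda>t. rcoef (c t) i) analytic_on {0})"


section \<open>The Volterra map and its iterates\<close>

fun volterra_w :: "triplet \<Rightarrow> complex" where
  "volterra_w (P, Q, R) = - (2 * coeff P 1 - coeff Q 1 + coeff R 1) / 2"

text \<open>The polynomial \<open>[:0, - w:]\<close> is \<open>- w x\<close>. On \<open>Mspace g\<close> the numerator \<open>2 P - Q + R\<close> has no constant term,
  so that the division is exact whenever \<open>w\<close> is nonzero. The rational map is defined precisely at
  the points of \<open>Mspace g\<close> where \<open>w\<close> does not vanish.\<close>

fun volterra :: "triplet \<Rightarrow> triplet" where
  "volterra (P, Q, R) =
     (let w = volterra_w (P, Q, R) in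
      (Q - P, (smult 2 P - Q + R) div [:0, - w:], [:0, - w:] * Q))"

definition volterra_domain :: "nat \<Rightarrow> triplet set" where
  "volterra_domain g = {m \<in> Mspace g. volterra_w m \<noteq> 0}"

text \<open>The map is injective on its domain, and its image there is the set of points of \<open>Mspace g\<close> where
  \<open>r\<^sub>1\<close> does not vanish (see \<open>bij_betw_volterra\<close> below); this image is the domain of the inverse.\<close>

definition volterra_inv :: "nat \<Rightarrow> triplet \<Rightarrow> triplet" where
  "volterra_inv g = inv_into (volterra_domain g) volterra"

definition volterra_iter :: "nat \<Rightarrow> int \<Rightarrow> triplet \<Rightarrow> triplet" where
  "volterra_iter g n m =
     (if n \<ge> 0 then (volterra ^^ nat n) m else (volterra_inv g ^^ nat (- n)) m)"

definition all_iterates_exist :: "nat \<Rightarrow> triplet \<Rightarrow> bool" where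
  "all_iterates_exist g m \<longleftrightarrow>
     (\<forall>k. (volterra ^^ k) m \<in> volterra_domain g) \<and>
     (\<forall>k. (volterra_inv g ^^ k) m \<in> volterra ` volterra_domain g)"

definition wseq :: "nat \<Rightarrow> (complex \<Rightarrow> triplet) \<Rightarrow> int \<Rightarrow> complex \<Rightarrow> complex" where
  "wseq g c n t = - rcoef (volterra_iter g n (c t)) 1 / 2"


section \<open>Genericity\<close>

inductive_set regular_fun :: "(triplet \<Rightarrow> complex) set" where
  const: "(\<lambda>m. a) \<in> regular_fun"
| p: "(\<lambda>m. pcoef m i) \<in> regular_fun"
| q: "(\<lambda>m. qcoef m i) \<in> regular_fun"
| r: "(\<lambda>m. rcoef m i) \<in> regular_fun"
| add: "f \<in> regular_fun \<Longrightarrow> h \<in> regular_fun \<Longrightarrow> (\<lambda>m. f m + h m) \<in> regular_fun"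
| mult: "f \<in> regular_fun \<Longrightarrow> h \<in> regular_fun \<Longrightarrow> (\<lambda>m. f m * h m) \<in> regular_fun"

text \<open>A property holds generically on the affine space \<open>Mspace g\<close> if it holds outside the union of
  countably many algebraic hypersurfaces. Countably many are needed here because every iterate of
  the Volterra map has its own indeterminacy locus.\<close>

definition generically :: "nat \<Rightarrow> (triplet \<Rightarrow> bool) \<Rightarrow> bool" where
  "generically g A \<longleftrightarrow>
     (\<exists>F. countable F \<and> F \<subseteq> regular_fun \<and> (\<forall>f\<in>F. \<exists>m\<in>Mspace g. f m \<noteq> 0) \<and>
          (\<forall>m\<in>Mspace g. (\<forall>f\<in>F. f m \<noteq> 0) \<longrightarrow> A m))"


section \<open>The Volterra map is a bijection between its domain and that of its inverse\<close>

lemma div_x_eq: "R div [:0, 1::complex:] = poly_shift 1 R"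
proof -
  have "R = pCons (coeff R 0) (poly_shift 1 R)"
    by (rule poly_eqI) (auto simp: coeff_pCons coeff_poly_shift split: nat.split)
  then have "R = [:0, 1:] * poly_shift 1 R + [:coeff R 0:]"
    by (simp add: one_pCons)
  then have "R div [:0, 1:] = ([:0, 1:] * poly_shift 1 R + [:coeff R 0:]) div [:0, 1:]"
    by metis
  also have "\<dots> = poly_shift 1 R + [:coeff R 0:] div [:0, 1:]"
    by (subst div_mult_self4) simp_all
  also have "[:coeff R 0:] div [:0, 1:] = 0"
    by (rule div_poly_less) simp
  finally show ?thesis by simp
qed

lemma div_wx_eq:
  assumes "w \<noteq> (0::complex)"
  shows "R div [:0, w:] = smult (inverse w) (poly_shift 1 R)"
proof -
  have "[:0, w:] = smult w [:0, 1:]" by simp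
  then show ?thesis using assms by (simp only: div_smult_right div_x_eq)
qed

lemma volterra_eq:
  assumes "volterra_w (P, Q, R) = w" "w \<noteq> 0"
  shows "volterra (P, Q, R) =
    (Q - P, smult (- inverse w) (poly_shift 1 (smult 2 P - Q + R)), [:0, - w:] * Q)"
  using assms div_wx_eq[of "- w"] by (simp add: Let_def del: volterra_w.simps)

lemma pCons_poly_shift: "coeff R 0 = 0 \<Longrightarrow> pCons 0 (poly_shift (Suc 0) R) = R"
  by (rule poly_eqI) (auto simp: coeff_pCons coeff_poly_shift split: nat.split)

lemma degree_le_iff: "degree P \<le> n \<longleftrightarrow> (\<forall>i>n. coeff P i = 0)"
  by (meson coeff_eq_0 degree_le le_trans linorder_not_less)

lemma bij_betw_volterra:
  "bij_betw volterra (volterra_domain g) {m \<in> Mspace g. rcoef m 1 \<noteq> 0}"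
proof -
  define W :: "triplet \<Rightarrow> triplet" where "W = (\<lambda>(P, Q, R).
      let w = - coeff R 1 / 2; Q' = smult (- inverse w) (poly_shift 1 R) in
      (Q' - P, Q', smult 2 P - Q' + [:0, - w:] * Q))"
  have W1: "W (volterra m) = m \<and> volterra m \<in> {m \<in> Mspace g. rcoef m 1 \<noteq> 0}"
    if m: "m \<in> volterra_domain g" for m
  proof -
    obtain P Q R where [simp]: "m = (P, Q, R)" by (cases m)
    define w where "w = volterra_w (P, Q, R)"
    have w: "w \<noteq> 0" and M: "m \<in> Mspace g"
      using m by (simp_all add: volterra_domain_def w_def)
    have w1: "2 * coeff P 1 - coeff Q 1 + coeff R 1 = - 2 * w"
      by (simp add: w_def)
    have eq: "volterra m = (Q - P, smult (- inverse w) (poly_shift 1 (smult 2 P - Q + R)), [:0, - w:] * Q)"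
      using volterra_eq[OF w_def[symmetric] w] by simp
    have r1: "coeff ([:0, - w:] * Q) 1 = - 2 * w" using M by (simp add: Mspace_def)
    have sh: "poly_shift 1 ([:0, - w:] * Q) = smult (- w) Q"
      by (rule poly_eqI) (simp add: coeff_poly_shift)
    have Q: "smult (- inverse w) (poly_shift 1 ([:0, - w:] * Q)) = Q"
      unfolding sh using w by simp
    have R: "[:0, - w:] * smult (- inverse w) (poly_shift 1 (smult 2 P - Q + R)) = smult 2 P - Q + R"
      using w M by (simp add: pCons_poly_shift Mspace_def)
    have "W (volterra m) = m"
    proof -
      have dbl: "smult 2 (Q - P) - Q + (smult 2 P - Q + R) = R"
        by (rule poly_eqI) (simp only: coeff_add coeff_diff coeff_smult, simp add: algebra_simps)
      have half: "- (- 2 * w) / 2 = w" by simp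
      show ?thesis unfolding eq W_def prod.case Let_def r1 half Q R dbl by simp
    qed
    moreover have "volterra m \<in> Mspace g"
      using M w w1 unfolding eq
      by (auto simp: Mspace_def degree_le_iff coeff_pCons coeff_poly_shift field_simps
          split: nat.splits)
    moreover have "rcoef (volterra m) 1 \<noteq> 0"
      unfolding eq rcoef_def snd_conv r1 using w by simp
    ultimately show ?thesis by blast
  qed
  have W2: "volterra (W m) = m \<and> W m \<in> volterra_domain g"
    if m: "m \<in> {m \<in> Mspace g. rcoef m 1 \<noteq> 0}" for m
  proof -
    obtain P Q R where [simp]: "m = (P, Q, R)" by (cases m)
    define w where "w = - coeff R 1 / 2"
    define Q' where "Q' = smult (- inverse w) (poly_shift 1 R)"
    have w: "w \<noteq> 0" and r1: "coeff R 1 = - 2 * w" and M: "m \<in> Mspace g"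
      using m by (simp_all add: rcoef_def w_def)
    have eq: "W m = (Q' - P, Q', smult 2 P - Q' + [:0, - w:] * Q)"
      by (simp add: W_def Let_def w_def Q'_def)
    have Q'1: "inverse w * coeff R (Suc 0) = - 2"
      using w r1 by simp
    have vw: "volterra_w (W m) = w"
      unfolding eq using M by (simp add: Mspace_def)
    have sh: "poly_shift 1 ([:0, - w:] * Q) = smult (- w) Q"
      by (rule poly_eqI) (simp add: coeff_poly_shift)
    have sum: "smult 2 (Q' - P) - Q' + (smult 2 P - Q' + [:0, - w:] * Q) = [:0, - w:] * Q"
      by (rule poly_eqI) (simp only: coeff_add coeff_diff coeff_smult, simp add: algebra_simps)
    have R: "[:0, - w:] * Q' = R"
      using w M by (simp add: Q'_def pCons_poly_shift Mspace_def)
    have "volterra (W m) = m"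
      using volterra_eq[OF vw[unfolded eq] w] w R unfolding eq sum sh by simp
    moreover have "W m \<in> Mspace g"
      using M Q'1 unfolding eq
      by (auto simp: Mspace_def degree_le_iff Q'_def coeff_pCons coeff_poly_shift split: nat.splits)
    ultimately show ?thesis using vw w by (simp add: volterra_domain_def)
  qed
  show ?thesis
    by (rule bij_betw_byWitness[where f' = W]) (use W1 W2 in blast)+
qed

end

theory Submission
  imports Defs
begin

text \<open>The Volterra map and its inverse are rational and map integral curves of \<open>X1\<close> to integral curves,
  which is checked on coefficients. Hence every iterate of the given curve satisfies \<open>X1\<close>, and
  the lattice equation is the \<open>r\<^sub>1\<close>-component of \<open>X1\<close>, with \<open>w\<^bsub>n+1\<^esub>\<close> and \<open>w\<^bsub>n-1\<^esub>\<close> read off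
  from one application of the map and of its inverse. An iterate is defined outside a sparse set of
  times because the meromorphic function controlling the indeterminacy is nonzero at time 0.
  Genericity holds because the Volterra map has the fixed point \<open>(1, 2, - 2 x)\<close>, at which
  none of the polynomials cutting out the indeterminacy loci vanishes.\<close>

section \<open>Coordinates, and coefficient formulas for the vector field and the two maps\<close>

text \<open>Collecting the three families in one set lets rationality, meromorphy and continuity of
  a triplet-valued map be stated by a single quantifier.\<close>

definition coords :: "(triplet \<Rightarrow> complex) set" where
  "coords = (\<Union>i. {\<lambda>m. pcoef m i, \<lambda>m. qcoef m i, \<lambda>m. rcoef m i})"

lemma coords_ballI:
  assumes "\<And>i. P (\<lambda>m. pcoef m i)" "\<And>i. P (\<lambda>m. qcoef m i)" "\<And>i. P (\<lambda>m. rcoef m i)"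
  shows "\<forall>f\<in>coords. P f"
  using assms by (auto simp: coords_def)

lemma coords_mem [simp]:
  "(\<lambda>m. pcoef m i) \<in> coords" "(\<lambda>m. qcoef m i) \<in> coords" "(\<lambda>m. rcoef m i) \<in> coords"
  by (auto simp: coords_def)

lemma Mspace_coef:
  assumes "m \<in> Mspace g"
  shows "pcoef m 0 = 1" "qcoef m 0 = 2" "rcoef m 0 = 0"
  using assms by (auto simp: Mspace_def pcoef_def qcoef_def rcoef_def)

text \<open>Division by \<open>[:0, 1:]\<close> drops the constant coefficient and shifts the others
  down, so these formulas hold at every triplet, also where the division is not exact.\<close>

lemma X1_coef:
  "pcoef (X1 m) i = rcoef m (Suc i) - rcoef m 1 / 2 * qcoef m i"
  "qcoef (X1 m) i = (2 * pcoef m 1 - qcoef m 1) / 2 * qcoef m i - (2 * pcoef m (Suc i) - qcoef m (Suc i))"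
  "rcoef (X1 m) i = rcoef m 1 * pcoef m i + (qcoef m 1 - 2 * pcoef m 1) / 2 * rcoef m i - rcoef m (Suc i)"
  by (cases m, simp add: pcoef_def qcoef_def rcoef_def Let_def div_x_eq[simplified] coeff_poly_shift)+

lemma volterra_w_coef: "volterra_w m = - (2 * pcoef m 1 - qcoef m 1 + rcoef m 1) / 2"
  by (cases m) (simp add: pcoef_def qcoef_def rcoef_def)

lemma volterra_coef:
  assumes "volterra_w m \<noteq> 0"
  shows "pcoef (volterra m) i = qcoef m i - pcoef m i"
    and "qcoef (volterra m) i =
           - (2 * pcoef m (Suc i) - qcoef m (Suc i) + rcoef m (Suc i)) / volterra_w m"
    and "rcoef (volterra m) 0 = 0"
    and "rcoef (volterra m) (Suc i) = - volterra_w m * qcoef m i"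
proof -
  obtain P Q R where m: "m = (P, Q, R)" by (cases m)
  have *: "volterra m =
    (Q - P, smult (- inverse (volterra_w m)) (poly_shift 1 (smult 2 P - Q + R)), [:0, - volterra_w m:] * Q)"
    using volterra_eq[OF refl, of P Q R] assms unfolding m by blast
  show "pcoef (volterra m) i = qcoef m i - pcoef m i"
    "qcoef (volterra m) i =
           - (2 * pcoef m (Suc i) - qcoef m (Suc i) + rcoef m (Suc i)) / volterra_w m"
    "rcoef (volterra m) 0 = 0"
    "rcoef (volterra m) (Suc i) = - volterra_w m * qcoef m i"
    unfolding * using assms
    by (simp_all add: m pcoef_def qcoef_def rcoef_def coeff_poly_shift field_simps
        del: volterra_w.simps)
qed

lemma volterra_domainD: "m \<in> volterra_domain g \<Longrightarrow> m \<in> Mspace g" "m \<in> volterra_domain g \<Longrightarrow> volterra_w m \<noteq> 0"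
  by (auto simp: volterra_domain_def)

lemma volterra_image: "volterra ` volterra_domain g = {m \<in> Mspace g. rcoef m 1 \<noteq> 0}"
  using bij_betw_volterra by (rule bij_betw_imp_surj_on)

lemma volterra_inv_in_domain:
  "m \<in> Mspace g \<Longrightarrow> rcoef m 1 \<noteq> 0 \<Longrightarrow> volterra_inv g m \<in> volterra_domain g"
  unfolding volterra_inv_def using volterra_image[of g] by (intro inv_into_into) auto

lemma volterra_volterra_inv:
  "m \<in> Mspace g \<Longrightarrow> rcoef m 1 \<noteq> 0 \<Longrightarrow> volterra (volterra_inv g m) = m"
  unfolding volterra_inv_def using volterra_image[of g] by (intro f_inv_into_f) auto

lemma volterra_inv_volterra: "m \<in> volterra_domain g \<Longrightarrow> volterra_inv g (volterra m) = m"
  unfolding volterra_inv_def using bij_betw_volterra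
  by (intro inv_into_f_f) (auto simp: bij_betw_def)

text \<open>The factor 2 is the constant term of Q in - w x Q. Thus the w of a point can be read off
  from its image.\<close>

lemma rcoef_1_volterra: "m \<in> volterra_domain g \<Longrightarrow> rcoef (volterra m) 1 = - 2 * volterra_w m"
  using volterra_coef(4)[of m 0] Mspace_coef(2)[of m g] by (simp add: volterra_domain_def)

text \<open>The formulas for \<open>volterra\<close> at the preimage \<open>n\<close> are solved in
  turn: the third component of \<open>m\<close> gives the Q of \<open>n\<close>, the first then
  gives P, and the second gives R. The value \<open>volterra_w n\<close> is already known from
  \<open>rcoef m 1\<close>.\<close>

lemma volterra_inv_coef:
  assumes "m \<in> Mspace g" "rcoef m 1 \<noteq> 0"
  shows "pcoef (volterra_inv g m) i = 2 * rcoef m (Suc i) / rcoef m 1 - pcoef m i"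
    and "qcoef (volterra_inv g m) i = 2 * rcoef m (Suc i) / rcoef m 1"
    and "rcoef (volterra_inv g m) 0 = 0"
    and "rcoef (volterra_inv g m) (Suc i) =
           2 * pcoef m (Suc i) + rcoef m 1 / 2 * qcoef m i - 2 * rcoef m (Suc (Suc i)) / rcoef m 1"
proof -
  define n where n_def: "n = volterra_inv g m"
  have n: "n \<in> volterra_domain g" and m: "volterra n = m"
    using assms by (auto simp: n_def volterra_inv_in_domain volterra_volterra_inv)
  have w: "volterra_w n \<noteq> 0" using n by (simp add: volterra_domain_def)
  have r1: "rcoef m 1 = - 2 * volterra_w n" using rcoef_1_volterra[OF n] m by simp
  have q: "qcoef n i = 2 * rcoef m (Suc i) / rcoef m 1" for i
    unfolding r1 using volterra_coef(4)[OF w, of i] w by (simp add: m field_simps)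
  have p: "pcoef n i = 2 * rcoef m (Suc i) / rcoef m 1 - pcoef m i" for i
    using volterra_coef(1)[OF w, of i] q by (simp add: m)
  have "qcoef m i * volterra_w n = - (2 * pcoef n (Suc i) - qcoef n (Suc i) + rcoef n (Suc i))"
    using volterra_coef(2)[OF w, of i] w by (simp add: m)
  then have "rcoef n (Suc i) = - 2 * pcoef n (Suc i) + qcoef n (Suc i) + rcoef m 1 / 2 * qcoef m i"
    unfolding r1 by (simp add: algebra_simps)
  then show "rcoef (volterra_inv g m) (Suc i) =
           2 * pcoef m (Suc i) + rcoef m 1 / 2 * qcoef m i - 2 * rcoef m (Suc (Suc i)) / rcoef m 1"
    unfolding n_def[symmetric] p q by (simp add: algebra_simps)
  show "rcoef (volterra_inv g m) 0 = 0"
    using Mspace_coef(3)[of n g] n by (simp add: n_def volterra_domain_def)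
  show "pcoef (volterra_inv g m) i = 2 * rcoef m (Suc i) / rcoef m 1 - pcoef m i"
    "qcoef (volterra_inv g m) i = 2 * rcoef m (Suc i) / rcoef m 1"
    using p q by (simp_all add: n_def)
qed


section \<open>Rational functions on subsets of the space of triplets\<close>

text \<open>One fraction has to serve on all of \<open>S\<close>, with a denominator nowhere zero
  there; off \<open>S\<close> the function is arbitrary. The single numerator later supplies a
  single hypersurface for each iterate.\<close>

definition rational_on :: "triplet set \<Rightarrow> (triplet \<Rightarrow> complex) \<Rightarrow> bool" where
  "rational_on S f \<longleftrightarrow>
     (\<exists>N\<in>regular_fun. \<exists>E\<in>regular_fun. \<forall>m\<in>S. E m \<noteq> 0 \<and> f m = N m / E m)"

lemma rational_onI:
  assumes "N \<in> regular_fun" "E \<in> regular_fun" "\<And>m. m \<in> S \<Longrightarrow> E m \<noteq> 0" "\<And>m. m \<in> S \<Longrightarrow> f m = N m / E m"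
  shows "rational_on S f"
  using assms unfolding rational_on_def by blast

lemma rational_onE:
  assumes "rational_on S f"
  obtains N E where "N \<in> regular_fun" "E \<in> regular_fun" "\<And>m. m \<in> S \<Longrightarrow> E m \<noteq> 0"
    "\<And>m. m \<in> S \<Longrightarrow> f m = N m / E m"
  using assms unfolding rational_on_def by blast

lemma rational_on_cong: "(\<And>m. m \<in> S \<Longrightarrow> f m = h m) \<Longrightarrow> rational_on S h \<Longrightarrow> rational_on S f"
  unfolding rational_on_def by (metis (no_types, lifting))

lemma rational_on_subset: "rational_on S f \<Longrightarrow> S' \<subseteq> S \<Longrightarrow> rational_on S' f"
  unfolding rational_on_def by (meson subsetD)

lemma rational_on_regular: "f \<in> regular_fun \<Longrightarrow> rational_on S f"
  by (rule rational_onI[of f "\<lambda>_. 1"]) (auto intro: regular_fun.intros)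

lemma rational_on_add:
  assumes "rational_on S f" "rational_on S h"
  shows "rational_on S (\<lambda>m. f m + h m)"
proof -
  from assms(1) obtain N E where 1: "N \<in> regular_fun" "E \<in> regular_fun" "\<And>m. m \<in> S \<Longrightarrow> E m \<noteq> 0"
    "\<And>m. m \<in> S \<Longrightarrow> f m = N m / E m" by (rule rational_onE) blast
  from assms(2) obtain N' E' where 2: "N' \<in> regular_fun" "E' \<in> regular_fun" "\<And>m. m \<in> S \<Longrightarrow> E' m \<noteq> 0"
    "\<And>m. m \<in> S \<Longrightarrow> h m = N' m / E' m" by (rule rational_onE) blast
  show ?thesis
    by (rule rational_onI[of "\<lambda>m. N m * E' m + N' m * E m" "\<lambda>m. E m * E' m"])
      (use 1 2 in \<open>auto intro: regular_fun.intros simp: field_simps\<close>)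
qed

lemma rational_on_mult:
  assumes "rational_on S f" "rational_on S h"
  shows "rational_on S (\<lambda>m. f m * h m)"
proof -
  from assms(1) obtain N E where 1: "N \<in> regular_fun" "E \<in> regular_fun" "\<And>m. m \<in> S \<Longrightarrow> E m \<noteq> 0"
    "\<And>m. m \<in> S \<Longrightarrow> f m = N m / E m" by (rule rational_onE) blast
  from assms(2) obtain N' E' where 2: "N' \<in> regular_fun" "E' \<in> regular_fun" "\<And>m. m \<in> S \<Longrightarrow> E' m \<noteq> 0"
    "\<And>m. m \<in> S \<Longrightarrow> h m = N' m / E' m" by (rule rational_onE) blast
  show ?thesis
    by (rule rational_onI[of "\<lambda>m. N m * N' m" "\<lambda>m. E m * E' m"])
      (use 1 2 in \<open>auto intro: regular_fun.intros\<close>)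
qed

lemma rational_on_inverse:
  assumes "rational_on S f" "\<And>m. m \<in> S \<Longrightarrow> f m \<noteq> 0"
  shows "rational_on S (\<lambda>m. inverse (f m))"
proof -
  from assms(1) obtain N E where 1: "N \<in> regular_fun" "E \<in> regular_fun" "\<And>m. m \<in> S \<Longrightarrow> E m \<noteq> 0"
    "\<And>m. m \<in> S \<Longrightarrow> f m = N m / E m" by (rule rational_onE) blast
  show ?thesis
    by (rule rational_onI[of E N]) (use 1 assms(2) in auto)
qed

lemma rational_on_const: "rational_on S (\<lambda>_. a)"
  by (intro rational_on_regular regular_fun.intros)

lemma rational_on_uminus: "rational_on S f \<Longrightarrow> rational_on S (\<lambda>m. - f m)"
  using rational_on_mult[OF rational_on_const[of S "- 1"]] by simp

lemma rational_on_diff: "rational_on S f \<Longrightarrow> rational_on S h \<Longrightarrow> rational_on S (\<lambda>m. f m - h m)"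
  using rational_on_add[of S f "\<lambda>m. - h m"] by (simp add: rational_on_uminus)

lemma rational_on_divide:
  "rational_on S f \<Longrightarrow> rational_on S h \<Longrightarrow> (\<And>m. m \<in> S \<Longrightarrow> h m \<noteq> 0) \<Longrightarrow> rational_on S (\<lambda>m. f m / h m)"
  using rational_on_mult[of S f "\<lambda>m. inverse (h m)"] by (simp add: rational_on_inverse divide_inverse)

lemma rational_on_coords:
  "rational_on S (\<lambda>m. pcoef m i)" "rational_on S (\<lambda>m. qcoef m i)" "rational_on S (\<lambda>m. rcoef m i)"
  by (auto intro!: rational_on_regular regular_fun.intros)

lemmas rational_intros = rational_on_add rational_on_mult rational_on_uminus rational_on_diff
  rational_on_divide rational_on_const rational_on_coords

text \<open>Regular functions are generated by constants and coordinates under sums and products, so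
  induction over \<open>regular_fun\<close> reduces the claim to coordinates. The same pattern gives
  meromorphy and continuity along a curve.\<close>

lemma rational_on_compose_regular:
  assumes "f \<in> regular_fun" "\<forall>f\<in>coords. rational_on S (\<lambda>m. f (T m))"
  shows "rational_on S (\<lambda>m. f (T m))"
  using assms(1)
proof induction
  case (p i) show ?case using bspec[OF assms(2) coords_mem(1)[of i]] by simp
next
  case (q i) show ?case using bspec[OF assms(2) coords_mem(2)[of i]] by simp
next
  case (r i) show ?case using bspec[OF assms(2) coords_mem(3)[of i]] by simp
qed (auto intro: rational_intros)

lemma rational_on_compose:
  assumes "rational_on U f" "\<forall>f\<in>coords. rational_on S (\<lambda>m. f (T m))" "T ` S \<subseteq> U"
  shows "rational_on S (\<lambda>m. f (T m))"
proof -
  from assms(1) obtain N E where 1: "N \<in> regular_fun" "E \<in> regular_fun" "\<And>m. m \<in> U \<Longrightarrow> E m \<noteq> 0"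
    "\<And>m. m \<in> U \<Longrightarrow> f m = N m / E m" by (rule rational_onE) blast
  have "rational_on S (\<lambda>m. N (T m) / E (T m))"
    using 1 assms(3) by (intro rational_on_divide rational_on_compose_regular assms(2)) blast+
  then show ?thesis
    by (rule rational_on_cong[rotated]) (use 1(4) assms(3) in blast)
qed

lemma regular_fun_meromorphic:
  assumes "f \<in> regular_fun" "\<forall>f\<in>coords. (\<lambda>t. f (c t)) meromorphic_on A"
  shows "(\<lambda>t. f (c t)) meromorphic_on A"
  using assms(1)
proof induction
  case (p i) show ?case using bspec[OF assms(2) coords_mem(1)[of i]] by simp
next
  case (q i) show ?case using bspec[OF assms(2) coords_mem(2)[of i]] by simp
next
  case (r i) show ?case using bspec[OF assms(2) coords_mem(3)[of i]] by simp
qed (auto intro: meromorphic_intros)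

lemma regular_fun_isCont:
  assumes "f \<in> regular_fun" "\<forall>f\<in>coords. isCont (\<lambda>t. f (c t)) z"
  shows "isCont (\<lambda>t. f (c t)) z"
  using assms(1)
proof induction
  case (p i) show ?case using bspec[OF assms(2) coords_mem(1)[of i]] by simp
next
  case (q i) show ?case using bspec[OF assms(2) coords_mem(2)[of i]] by simp
next
  case (r i) show ?case using bspec[OF assms(2) coords_mem(3)[of i]] by simp
qed (auto intro: continuous_intros)


section \<open>Rational maps preserving the flow\<close>

text \<open>The value of a meromorphic curve at a pole is arbitrary, hence such a curve stays in the space
  of triplets only up to a sparse set once a rational map has been applied to it.\<close>

definition flow_curve :: "nat \<Rightarrow> (complex \<Rightarrow> triplet) \<Rightarrow> bool" where
  "flow_curve g c \<longleftrightarrow>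
     (\<forall>f\<in>coords. (\<lambda>t. f (c t)) meromorphic_on UNIV \<and> isCont (\<lambda>t. f (c t)) 0) \<and>
     (\<forall>\<^sub>\<approx>t\<in>UNIV. c t \<in> Mspace g \<and> has_triplet_derivative c (X1 (c t)) t)"

text \<open>Every point has a punctured neighbourhood on which \<open>P\<close> holds, and each
  point of that set has a full neighbourhood inside it. This upgrades pointwise statements to what
  differentiation requires.\<close>

lemma eventually_cosparse_nhds:
  fixes P :: "'a :: t1_space \<Rightarrow> bool"
  assumes "eventually P (cosparse UNIV)"
  shows "\<forall>\<^sub>\<approx>t\<in>UNIV. eventually P (nhds t)"
proof -
  have "\<forall>\<^sub>F t in at x. eventually P (nhds t)" for x
  proof -
    have "eventually P (at x)"
      using assms by (simp add: eventually_cosparse_open_eq)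
    then obtain S where S: "open S" "x \<in> S" "\<And>y. y \<in> S \<Longrightarrow> y \<noteq> x \<Longrightarrow> P y"
      unfolding eventually_at_topological by auto
    have "eventually P (nhds y)" if "y \<in> S" "y \<noteq> x" for y
      unfolding eventually_nhds
      by (rule exI[of _ "S - {x}"]) (use S that in \<open>auto intro: open_delete\<close>)
    then show ?thesis
      unfolding eventually_at_topological using S(1,2) by blast
  qed
  then show ?thesis by (simp add: eventually_cosparse_open_eq)
qed

lemma flow_curve_regular:
  assumes "flow_curve g c" "f \<in> regular_fun"
  shows "(\<lambda>t. f (c t)) meromorphic_on UNIV" "isCont (\<lambda>t. f (c t)) 0"
  using assms by (simp_all add: flow_curve_def regular_fun_meromorphic regular_fun_isCont)

text \<open>This captures what \<open>volterra\<close> and \<open>volterra_inv\<close> have in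
  common, \<open>h\<close> being the polynomial whose zeros form the indeterminacy locus. In
  \<open>derivative\<close> the curve must stay in \<open>U\<close> near \<open>t\<close>, since the
  formulas for \<open>T\<close> are differentiated there.\<close>

locale flow_symmetry =
  fixes g :: nat and h :: "triplet \<Rightarrow> complex" and T :: "triplet \<Rightarrow> triplet" and U :: "triplet set"
  defines "U \<equiv> {m \<in> Mspace g. h m \<noteq> 0}"
  assumes regular: "h \<in> regular_fun"
    and into: "m \<in> U \<Longrightarrow> T m \<in> Mspace g"
    and rational: "\<forall>f\<in>coords. rational_on U (\<lambda>m. f (T m))"
    and derivative: "\<lbrakk>\<forall>\<^sub>F s in nhds t. c s \<in> U; has_triplet_derivative c (X1 (c t)) t\<rbrakk>
          \<Longrightarrow> has_triplet_derivative (\<lambda>s. T (c s)) (X1 (T (c t))) t"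
begin

text \<open>Membership of all earlier iterates in \<open>U\<close> ensures that every application of
  \<open>T\<close> takes place where its denominators do not vanish.\<close>

lemma iterate_rational:
  "\<forall>f\<in>coords. rational_on {m \<in> Mspace g. \<forall>j<k. (T ^^ j) m \<in> U} (\<lambda>m. f ((T ^^ k) m))"
proof (induction k)
  case 0
  show ?case by (auto simp: coords_def intro: rational_intros)
next
  case (Suc k)
  let ?S = "{m \<in> Mspace g. \<forall>j<Suc k. (T ^^ j) m \<in> U}"
  have "\<forall>f\<in>coords. rational_on ?S (\<lambda>m. f ((T ^^ k) m))"
    using Suc by (auto intro: rational_on_subset)
  moreover have "(T ^^ k) ` ?S \<subseteq> U" by auto
  ultimately have "\<forall>f\<in>coords. rational_on ?S (\<lambda>m. f (T ((T ^^ k) m)))"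
    using rational rational_on_compose[of U "\<lambda>m. f (T m)" ?S "T ^^ k" for f] by blast
  then show ?case by simp
qed

text \<open>The \<open>k\<close>-th hypersurface is cut out by a numerator of \<open>h\<close>
  composed with the \<open>k\<close>-th iterate. All of them are proper because none contains the
  fixed point \<open>m0\<close>.\<close>

lemma generically_iterates:
  assumes "m0 \<in> U" "T m0 = m0"
  shows "generically g (\<lambda>m. \<forall>k. (T ^^ k) m \<in> U)"
proof -
  define S where "S k = {m \<in> Mspace g. \<forall>j<k. (T ^^ j) m \<in> U}" for k
  have "\<exists>N. N \<in> regular_fun \<and> (\<forall>m\<in>S k. N m = 0 \<longleftrightarrow> h ((T ^^ k) m) = 0)" for k
  proof -
    have "rational_on (S k) (\<lambda>m. h ((T ^^ k) m))"
      using rational_on_compose_regular[OF regular iterate_rational] by (simp add: S_def)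
    then show ?thesis by (rule rational_onE) auto
  qed
  then obtain N where N: "\<And>k. N k \<in> regular_fun"
    "\<And>k m. m \<in> S k \<Longrightarrow> N k m = 0 \<longleftrightarrow> h ((T ^^ k) m) = 0"
    by metis
  have fix_iter: "(T ^^ k) m0 = m0" for k
    by (induction k) (simp_all add: assms)
  have m0: "m0 \<in> S k" "m0 \<in> Mspace g" "h m0 \<noteq> 0" for k
    using assms fix_iter by (auto simp: S_def U_def)
  have N0: "N k m0 \<noteq> 0" for k
    using N(2)[OF m0(1)] m0(3) by (simp add: fix_iter)
  \<comment> \<open>\<open>N k\<close> is tied to the iterate only on \<open>S k\<close>; strong
    induction first places \<open>m\<close> in \<open>S k\<close>.\<close>
  have "(T ^^ k) m \<in> U" if m: "m \<in> Mspace g" and nz: "\<And>k. N k m \<noteq> 0" for m k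
  proof (induction k rule: less_induct)
    case (less k)
    then have "m \<in> S k" using m by (auto simp: S_def)
    then have "h ((T ^^ k) m) \<noteq> 0" using N(2) nz by blast
    moreover have "(T ^^ k) m \<in> Mspace g"
      using m less[of "k - 1"] into by (cases k) auto
    ultimately show ?case by (simp add: U_def)
  qed
  then show ?thesis
    unfolding generically_def
    by (intro exI[of _ "range N"]) (use N(1) N0 m0(2) in \<open>auto intro!: bexI[of _ m0]\<close>)
qed

text \<open>A meromorphic function on the plane vanishes off a sparse set or is nonzero off a sparse
  set. Continuity of \<open>h\<close> along the curve at 0, with a nonzero value there, excludes the
  first case.\<close>

lemma flow_curve_in_domain:
  assumes c: "flow_curve g c" and "c 0 \<in> U"
  shows "\<forall>\<^sub>\<approx>t\<in>UNIV. c t \<in> U" "\<forall>\<^sub>F t in nhds 0. c t \<in> U"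
proof -
  have mero: "(\<lambda>t. h (c t)) meromorphic_on UNIV" and cont: "isCont (\<lambda>t. h (c t)) 0"
    using flow_curve_regular[OF c regular] by auto
  have "h (c 0) \<noteq> 0" using assms(2) by (simp add: U_def)
  with cont have ev: "\<forall>\<^sub>F t in at 0. h (c t) \<noteq> 0"
    by (auto simp: isCont_def intro: tendsto_imp_eventually_ne)
  have "(\<forall>\<^sub>\<approx>t\<in>UNIV. h (c t) = 0) \<or> (\<forall>\<^sub>\<approx>t\<in>UNIV. h (c t) \<noteq> 0)"
    by (rule meromorphic_imp_constant_or_avoid[OF mero]) auto
  moreover have "\<not> (\<forall>\<^sub>\<approx>t\<in>UNIV. h (c t) = 0)"
  proof
    assume "\<forall>\<^sub>\<approx>t\<in>UNIV. h (c t) = 0"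
    then have "\<forall>\<^sub>F t in at 0. h (c t) = 0" by (auto simp: eventually_cosparse_open_eq)
    with ev have "\<forall>\<^sub>F t in at (0::complex). False" by eventually_elim simp
    then show False by simp
  qed
  ultimately have "\<forall>\<^sub>\<approx>t\<in>UNIV. h (c t) \<noteq> 0" by blast
  moreover have "\<forall>\<^sub>\<approx>t\<in>UNIV. c t \<in> Mspace g"
    using c by (auto simp: flow_curve_def elim: eventually_mono)
  ultimately show *: "\<forall>\<^sub>\<approx>t\<in>UNIV. c t \<in> U"
    by eventually_elim (simp add: U_def)
  then show "\<forall>\<^sub>F t in nhds 0. c t \<in> U"
    using assms(2) by (auto simp: eventually_cosparse_open_eq eventually_nhds_conv_at)
qed

lemma flow_curve_map:
  assumes c: "flow_curve g c" and "c 0 \<in> U"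
  shows "flow_curve g (\<lambda>t. T (c t))"
proof -
  note dom = flow_curve_in_domain[OF assms]
  have "(\<lambda>t. f (T (c t))) meromorphic_on UNIV \<and> isCont (\<lambda>t. f (T (c t))) 0" if "f \<in> coords" for f
  proof -
    have "rational_on U (\<lambda>m. f (T m))" using rational that by blast
    then obtain N E where NE: "N \<in> regular_fun" "E \<in> regular_fun" "\<And>m. m \<in> U \<Longrightarrow> E m \<noteq> 0"
      "\<And>m. m \<in> U \<Longrightarrow> f (T m) = N m / E m" by (rule rational_onE) blast
    have "(\<lambda>t. N (c t) / E (c t)) meromorphic_on UNIV" "isCont (\<lambda>t. N (c t) / E (c t)) 0"
      using flow_curve_regular[OF c NE(1)] flow_curve_regular[OF c NE(2)] NE(3)[OF assms(2)]
      by (auto intro: meromorphic_on_divide isCont_divide)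
    moreover have "\<forall>\<^sub>\<approx>t\<in>UNIV. f (T (c t)) = N (c t) / E (c t)"
      using dom(1) by eventually_elim (rule NE(4))
    then have "(\<lambda>t. f (T (c t))) meromorphic_on UNIV \<longleftrightarrow> (\<lambda>t. N (c t) / E (c t)) meromorphic_on UNIV"
      by (intro meromorphic_on_cong) (auto simp: eventually_cosparse_open_eq)
    \<comment> \<open>Continuity depends on the value at 0 itself, so agreement on a full
      neighbourhood of 0 is used here; for meromorphy, agreement off a sparse set sufficed.\<close>
    moreover have "isCont (\<lambda>t. f (T (c t))) 0 \<longleftrightarrow> isCont (\<lambda>t. N (c t) / E (c t)) 0"
      using dom(2) by (intro isCont_cong) (auto elim!: eventually_mono intro: NE(4))
    ultimately show ?thesis by simp
  qed
  moreover have "\<forall>\<^sub>\<approx>t\<in>UNIV. has_triplet_derivative c (X1 (c t)) t"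
    using c by (auto simp: flow_curve_def elim: eventually_mono)
  then have "\<forall>\<^sub>\<approx>t\<in>UNIV. T (c t) \<in> Mspace g \<and> has_triplet_derivative (\<lambda>s. T (c s)) (X1 (T (c t))) t"
    using eventually_cosparse_nhds[OF dom(1)] dom(1)
    by eventually_elim (use into derivative in auto)
  ultimately show ?thesis by (simp add: flow_curve_def)
qed

end

text \<open>Stated without division in the assumptions, so that the identities to be checked are polynomial.\<close>

lemma DERIV_quotient_eq:
  fixes f h :: "'a :: real_normed_field \<Rightarrow> 'a"
  assumes "(f has_field_derivative f') (at t)" "(h has_field_derivative h') (at t)"
    and "h t \<noteq> 0" "f t = a * h t" "f' = x * h t + a * h'"
  shows "((\<lambda>s. f s / h s) has_field_derivative x) (at t)"
  using DERIV_divide[OF assms(1-3)] assms(3-) by (simp add: field_simps)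

section \<open>Invariance of the flow under the Volterra map and its inverse\<close>

text \<open>The coordinates of the image are differentiated by the sum, product and quotient rules,
  and the results are compared with \<open>X1\<close> at the image \<open>n\<close>.\<close>

lemma flow_symmetry_volterra: "flow_symmetry g volterra_w volterra"
proof
  show "volterra_w \<in> regular_fun"
  proof -
    have "(\<lambda>m. (- 1) * pcoef m 1 + (1 / 2 * qcoef m 1 + (- 1 / 2) * rcoef m 1)) \<in> regular_fun"
      by (intro regular_fun.intros)
    also have "(\<lambda>m. (- 1) * pcoef m 1 + (1 / 2 * qcoef m 1 + (- 1 / 2) * rcoef m 1)) = volterra_w"
      by (auto simp: volterra_w_coef field_simps)
    finally show ?thesis .
  qed
  fix m assume "m \<in> {m \<in> Mspace g. volterra_w m \<noteq> 0}"
  then show "volterra m \<in> Mspace g"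
    using volterra_image[of g] unfolding volterra_domain_def by blast
next
  have w: "rational_on S volterra_w" for S
    unfolding volterra_w_coef by (intro rational_intros) auto
  let ?U = "{m \<in> Mspace g. volterra_w m \<noteq> 0}"
  show "\<forall>f\<in>coords. rational_on ?U (\<lambda>m. f (volterra m))"
  proof (rule coords_ballI)
    fix i
    show "rational_on ?U (\<lambda>m. pcoef (volterra m) i)"
      by (rule rational_on_cong, rule volterra_coef(1), simp) (auto intro!: rational_intros w)
    show "rational_on ?U (\<lambda>m. qcoef (volterra m) i)"
      by (rule rational_on_cong, rule volterra_coef(2), simp) (auto intro!: rational_intros w)
    show "rational_on ?U (\<lambda>m. rcoef (volterra m) i)"
    proof (cases i)
      case 0
      show ?thesis unfolding 0
        by (rule rational_on_cong, rule volterra_coef(3), simp) (auto intro!: rational_intros w)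
    next
      case (Suc j)
      show ?thesis unfolding Suc
        by (rule rational_on_cong, rule volterra_coef(4), simp) (auto intro!: rational_intros w)
    qed
  qed
next
  fix t c
  assume ev: "\<forall>\<^sub>F s in nhds t. c s \<in> {m \<in> Mspace g. volterra_w m \<noteq> 0}"
    and D: "has_triplet_derivative c (X1 (c t)) t"
  define m where "m = c t"
  have m: "m \<in> Mspace g" "volterra_w m \<noteq> 0"
    using eventually_nhds_x_imp_x[OF ev] by (auto simp: m_def)
  have Dp: "((\<lambda>s. pcoef (c s) i) has_field_derivative pcoef (X1 m) i) (at t)"
    and Dq: "((\<lambda>s. qcoef (c s) i) has_field_derivative qcoef (X1 m) i) (at t)"
    and Dr: "((\<lambda>s. rcoef (c s) i) has_field_derivative rcoef (X1 m) i) (at t)" for i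
    using D by (auto simp: has_triplet_derivative_def m_def)
  define dw where "dw = - (2 * pcoef (X1 m) 1 - qcoef (X1 m) 1 + rcoef (X1 m) 1) / 2"
  have Dw: "((\<lambda>s. volterra_w (c s)) has_field_derivative dw) (at t)"
    unfolding volterra_w_coef dw_def by (auto intro!: derivative_eq_intros Dp Dq Dr)
  define n where "n = volterra m"
  define w where "w = volterra_w m"
  have w: "w \<noteq> 0" using m by (simp add: w_def)
  \<comment> \<open>Eliminating r_1 in favour of \<open>w\<close>, together with \<open>qw\<close>
    below, turns the identities to be checked into polynomial ones.\<close>
  have r1: "rcoef m (Suc 0) = - 2 * w - 2 * pcoef m (Suc 0) + qcoef m (Suc 0)"
    unfolding w_def volterra_w_coef by (simp add: field_simps)
  note V = volterra_coef[OF m(2), folded n_def w_def]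
  have qw: "w * qcoef n i = - (2 * pcoef m (Suc i) - qcoef m (Suc i) + rcoef m (Suc i))" for i
    unfolding V using w by simp
  have rn1: "rcoef n (Suc 0) = - 2 * w"
    using V(4)[of 0] Mspace_coef(2)[OF m(1)] by simp
  \<comment> \<open>The logarithmic derivative of w is half the difference of the q_1 coefficients
    of image and source.\<close>
  have dw: "dw = w * (qcoef n 1 - qcoef m 1) / 2"
    unfolding dw_def X1_coef right_diff_distrib qw by (simp add: r1 field_simps)
  note X = X1_coef[of m] X1_coef[of n]
  have at_t: "\<forall>\<^sub>F s in nhds t. volterra_w (c s) \<noteq> 0"
    using ev by eventually_elim simp
  have D1: "((\<lambda>s. qcoef (volterra (c s)) i) has_field_derivative qcoef (X1 n) i) (at t)" for i
  proof -
    let ?N = "\<lambda>s. - (2 * pcoef (c s) (Suc i) - qcoef (c s) (Suc i) + rcoef (c s) (Suc i))"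
    have "(?N has_field_derivative
       - (2 * pcoef (X1 m) (Suc i) - qcoef (X1 m) (Suc i) + rcoef (X1 m) (Suc i))) (at t)"
      by (auto intro!: derivative_eq_intros Dp Dq Dr)
    then have "((\<lambda>s. ?N s / volterra_w (c s)) has_field_derivative qcoef (X1 n) i) (at t)"
    proof (rule DERIV_quotient_eq[OF _ Dw])
      show "volterra_w (c t) \<noteq> 0" "?N t = qcoef n i * volterra_w (c t)"
        using m qw[of i] by (simp_all add: m_def w_def mult.commute)
      \<comment> \<open>The terms containing \<open>qcoef n 1\<close> cancel, and each remaining
        coefficient of the second component of \<open>n\<close> carries a factor \<open>w\<close>,
        ready for \<open>qw\<close>.\<close>
      have "qcoef (X1 n) i * w + qcoef n i * dw =
          (w * qcoef n i) * (2 * qcoef m 1 - 2 * pcoef m 1 - qcoef m 1) / 2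
          - 2 * w * (qcoef m (Suc i) - pcoef m (Suc i)) + w * qcoef n (Suc i)"
        unfolding dw X V(1) by (simp add: field_simps)
      also have "\<dots> = - (2 * pcoef (X1 m) (Suc i) - qcoef (X1 m) (Suc i) + rcoef (X1 m) (Suc i))"
        unfolding qw X by (simp add: r1 field_simps)
      finally show "- (2 * pcoef (X1 m) (Suc i) - qcoef (X1 m) (Suc i) + rcoef (X1 m) (Suc i)) =
          qcoef (X1 n) i * volterra_w (c t) + qcoef n i * dw"
        by (simp add: m_def w_def)
    qed
    moreover have "\<forall>\<^sub>F s in nhds t. qcoef (volterra (c s)) i = ?N s / volterra_w (c s)"
      using at_t by eventually_elim (rule volterra_coef(2))
    ultimately show ?thesis by (subst DERIV_cong_ev[OF refl _ refl])
  qed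
  have D2: "((\<lambda>s. pcoef (volterra (c s)) i) has_field_derivative pcoef (X1 n) i) (at t)" for i
  proof -
    have "((\<lambda>s. qcoef (c s) i - pcoef (c s) i) has_field_derivative qcoef (X1 m) i - pcoef (X1 m) i) (at t)"
      by (intro DERIV_diff Dp Dq)
    also have "qcoef (X1 m) i - pcoef (X1 m) i = - w * qcoef m i + w * qcoef n i"
      unfolding qw X by (simp add: r1 field_simps)
    also have "\<dots> = pcoef (X1 n) i"
      unfolding X V(4) by (simp add: rn1)
    finally have "((\<lambda>s. qcoef (c s) i - pcoef (c s) i) has_field_derivative pcoef (X1 n) i) (at t)" .
    moreover have "\<forall>\<^sub>F s in nhds t. pcoef (volterra (c s)) i = qcoef (c s) i - pcoef (c s) i"
      using at_t by eventually_elim (rule volterra_coef(1))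
    ultimately show ?thesis by (subst DERIV_cong_ev[OF refl _ refl])
  qed
  have D3: "((\<lambda>s. rcoef (volterra (c s)) (Suc i)) has_field_derivative rcoef (X1 n) (Suc i)) (at t)" for i
  proof -
    have "((\<lambda>s. - volterra_w (c s) * qcoef (c s) i) has_field_derivative - dw * qcoef m i - w * qcoef (X1 m) i) (at t)"
      by (auto intro!: derivative_eq_intros Dw Dq simp: m_def w_def)
    also have "- dw * qcoef m i - w * qcoef (X1 m) i = rcoef (X1 n) (Suc i)"
      unfolding X V(4) V(1) dw by (simp add: rn1 field_simps)
    finally have "((\<lambda>s. - volterra_w (c s) * qcoef (c s) i) has_field_derivative rcoef (X1 n) (Suc i)) (at t)" .
    moreover have "\<forall>\<^sub>F s in nhds t. rcoef (volterra (c s)) (Suc i) = - volterra_w (c s) * qcoef (c s) i"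
      using at_t by eventually_elim (rule volterra_coef(4))
    ultimately show ?thesis by (subst DERIV_cong_ev[OF refl _ refl])
  qed
  have D4: "((\<lambda>s. rcoef (volterra (c s)) 0) has_field_derivative rcoef (X1 n) 0) (at t)"
  proof -
    \<comment> \<open>This coefficient is r_1 (p_0 - 1) at \<open>n\<close>, where p_0 = 2 -
      1.\<close>
    have *: "rcoef (X1 n) 0 = 0"
      using Mspace_coef[OF m(1)] unfolding X V(3) V(1) by simp
    have "((\<lambda>s. 0) has_field_derivative rcoef (X1 n) 0) (at t)"
      unfolding * by (rule DERIV_const)
    moreover have "\<forall>\<^sub>F s in nhds t. rcoef (volterra (c s)) 0 = 0"
      using at_t by eventually_elim (rule volterra_coef(3))
    ultimately show ?thesis by (subst DERIV_cong_ev[OF refl _ refl])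
  qed
  have "((\<lambda>s. rcoef (volterra (c s)) i) has_field_derivative rcoef (X1 n) i) (at t)" for i
    using D3 D4 by (cases i) auto
  then show "has_triplet_derivative (\<lambda>s. volterra (c s)) (X1 (volterra (c t))) t"
    using D1 D2 by (simp add: has_triplet_derivative_def n_def m_def)
qed

text \<open>The verification is again by coefficients, now with \<open>\<rho>\<close>, the r_1 of
  \<open>m\<close>, as the only denominator.\<close>

lemma flow_symmetry_volterra_inv: "flow_symmetry g (\<lambda>m. rcoef m 1) (volterra_inv g)"
proof
  show "(\<lambda>m. rcoef m 1) \<in> regular_fun" by (rule regular_fun.r)
  fix m assume "m \<in> {m \<in> Mspace g. rcoef m 1 \<noteq> 0}"
  then show "volterra_inv g m \<in> Mspace g"
    using volterra_inv_in_domain volterra_domainD(1) by blast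
next
  let ?U = "{m \<in> Mspace g. rcoef m 1 \<noteq> 0}"
  show "\<forall>f\<in>coords. rational_on ?U (\<lambda>m. f (volterra_inv g m))"
  proof (rule coords_ballI)
    fix i
    show "rational_on ?U (\<lambda>m. pcoef (volterra_inv g m) i)"
      by (rule rational_on_cong, rule volterra_inv_coef(1)) (auto intro!: rational_intros)
    show "rational_on ?U (\<lambda>m. qcoef (volterra_inv g m) i)"
      by (rule rational_on_cong, rule volterra_inv_coef(2)) (auto intro!: rational_intros)
    show "rational_on ?U (\<lambda>m. rcoef (volterra_inv g m) i)"
    proof (cases i)
      case 0
      show ?thesis unfolding 0
        by (rule rational_on_cong, rule volterra_inv_coef(3)) (auto intro!: rational_intros)
    next
      case (Suc j)
      show ?thesis unfolding Suc
        by (rule rational_on_cong, rule volterra_inv_coef(4)) (auto intro!: rational_intros)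
    qed
  qed
next
  fix t c
  assume ev: "\<forall>\<^sub>F s in nhds t. c s \<in> {m \<in> Mspace g. rcoef m 1 \<noteq> 0}"
    and D: "has_triplet_derivative c (X1 (c t)) t"
  define m where "m = c t"
  define \<rho> where "\<rho> = rcoef m (Suc 0)"
  have m: "m \<in> Mspace g" "rcoef m 1 \<noteq> 0" and \<rho>: "\<rho> \<noteq> 0"
    using eventually_nhds_x_imp_x[OF ev] by (auto simp: m_def \<rho>_def)
  have Dp: "((\<lambda>s. pcoef (c s) i) has_field_derivative pcoef (X1 m) i) (at t)"
    and Dq: "((\<lambda>s. qcoef (c s) i) has_field_derivative qcoef (X1 m) i) (at t)"
    and Dr: "((\<lambda>s. rcoef (c s) i) has_field_derivative rcoef (X1 m) i) (at t)" for i
    using D by (auto simp: has_triplet_derivative_def m_def)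
  define n where "n = volterra_inv g m"
  note V = volterra_inv_coef[OF m, folded n_def]
  have q\<rho>: "\<rho> * qcoef n i = 2 * rcoef m (Suc i)" for i
    unfolding V using \<rho> by (simp add: \<rho>_def)
  have qm0: "qcoef m 0 = 2" by (rule Mspace_coef(2)[OF m(1)])
  have qn0: "qcoef n 0 = 2" using q\<rho>[of 0] \<rho> by (simp add: \<rho>_def)
  have pn: "pcoef n i = qcoef n i - pcoef m i" for i
    by (simp add: V)
  have rn: "rcoef n (Suc i) = 2 * pcoef m (Suc i) + \<rho> / 2 * qcoef m i - qcoef n (Suc i)" for i
    unfolding V by (simp add: \<rho>_def)
  have rn1: "rcoef n (Suc 0) = 2 * pcoef m (Suc 0) + \<rho> - qcoef n (Suc 0)"
    using rn[of 0] Mspace_coef(2)[OF m(1)] by simp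
  \<comment> \<open>The R of \<open>m\<close> is replaced by the Q of its preimage \<open>n\<close>,
    which removes division by \<open>\<rho>\<close> from the identities below.\<close>
  have r: "rcoef m (Suc i) = \<rho> * qcoef n i / 2" for i
    using q\<rho>[of i] by simp
  note X = X1_coef[of m, unfolded One_nat_def, folded \<rho>_def] X1_coef[of n, unfolded One_nat_def]
  \<comment> \<open>Since \<open>\<rho>\<close> is - 2 w at \<open>n\<close>, this is the same
    evolution law of w, with \<open>n\<close> as source and \<open>m\<close> as image.\<close>
  have d\<rho>: "rcoef (X1 m) (Suc 0) = \<rho> * (qcoef m (Suc 0) - qcoef n (Suc 0)) / 2"
    unfolding X r[of "Suc 0"] \<rho>_def[symmetric] by (simp add: field_simps)
  have at_t: "\<forall>\<^sub>F s in nhds t. c s \<in> Mspace g \<and> rcoef (c s) 1 \<noteq> 0"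
    using ev by eventually_elim simp
  have D1: "((\<lambda>s. qcoef (volterra_inv g (c s)) i) has_field_derivative qcoef (X1 n) i) (at t)" for i
  proof -
    have "((\<lambda>s. 2 * rcoef (c s) (Suc i)) has_field_derivative 2 * rcoef (X1 m) (Suc i)) (at t)"
      by (auto intro!: derivative_eq_intros Dr)
    then have "((\<lambda>s. 2 * rcoef (c s) (Suc i) / rcoef (c s) 1) has_field_derivative qcoef (X1 n) i) (at t)"
    proof (rule DERIV_quotient_eq[OF _ Dr])
      show "rcoef (c t) 1 \<noteq> 0" "2 * rcoef (c t) (Suc i) = qcoef n i * rcoef (c t) 1"
        using m q\<rho>[of i] by (simp_all add: m_def \<rho>_def mult.commute)
      have "2 * rcoef (X1 m) (Suc i) = qcoef (X1 n) i * \<rho> + qcoef n i * rcoef (X1 m) (Suc 0)"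
        unfolding d\<rho> X pn r by (simp add: qn0 field_simps)
      then show "2 * rcoef (X1 m) (Suc i) = qcoef (X1 n) i * rcoef (c t) 1 + qcoef n i * rcoef (X1 m) 1"
        by (simp add: m_def \<rho>_def)
    qed
    moreover have "\<forall>\<^sub>F s in nhds t. qcoef (volterra_inv g (c s)) i = 2 * rcoef (c s) (Suc i) / rcoef (c s) 1"
      using at_t by eventually_elim (rule volterra_inv_coef(2), auto)
    ultimately show ?thesis by (subst DERIV_cong_ev[OF refl _ refl])
  qed
  have D2: "((\<lambda>s. pcoef (volterra_inv g (c s)) i) has_field_derivative pcoef (X1 n) i) (at t)" for i
  proof -
    have "((\<lambda>s. qcoef (volterra_inv g (c s)) i - pcoef (c s) i)
        has_field_derivative qcoef (X1 n) i - pcoef (X1 m) i) (at t)"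
      by (intro DERIV_diff Dp D1)
    also have "qcoef (X1 n) i - pcoef (X1 m) i = pcoef (X1 n) i"
      unfolding X pn rn1 rn r by (simp add: qm0 qn0 field_simps)
    finally have "((\<lambda>s. qcoef (volterra_inv g (c s)) i - pcoef (c s) i)
        has_field_derivative pcoef (X1 n) i) (at t)" .
    moreover have "\<forall>\<^sub>F s in nhds t. pcoef (volterra_inv g (c s)) i = qcoef (volterra_inv g (c s)) i - pcoef (c s) i"
      using at_t by eventually_elim (simp add: volterra_inv_coef)
    ultimately show ?thesis by (subst DERIV_cong_ev[OF refl _ refl])
  qed
  have D3: "((\<lambda>s. rcoef (volterra_inv g (c s)) (Suc i)) has_field_derivative rcoef (X1 n) (Suc i)) (at t)" for i
  proof -
    \<comment> \<open>The quotient in the formula for R is kept as a coefficient of the new Q, so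
      that \<open>D1\<close> supplies its derivative.\<close>
    let ?f = "\<lambda>s. 2 * pcoef (c s) (Suc i) + rcoef (c s) 1 / 2 * qcoef (c s) i
      - qcoef (volterra_inv g (c s)) (Suc i)"
    have "(?f has_field_derivative 2 * pcoef (X1 m) (Suc i) +
        (rcoef (X1 m) (Suc 0) / 2 * qcoef m i + \<rho> / 2 * qcoef (X1 m) i) - qcoef (X1 n) (Suc i)) (at t)"
      by (auto intro!: derivative_eq_intros Dp Dq Dr D1 simp: m_def \<rho>_def)
    also have "2 * pcoef (X1 m) (Suc i) +
        (rcoef (X1 m) (Suc 0) / 2 * qcoef m i + \<rho> / 2 * qcoef (X1 m) i) - qcoef (X1 n) (Suc i)
        = rcoef (X1 n) (Suc i)"
      unfolding d\<rho> X pn rn1 rn r by (simp add: qm0 qn0 field_simps)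
    finally have "(?f has_field_derivative rcoef (X1 n) (Suc i)) (at t)" .
    moreover have "\<forall>\<^sub>F s in nhds t. rcoef (volterra_inv g (c s)) (Suc i) = ?f s"
      using at_t by eventually_elim (simp add: volterra_inv_coef)
    ultimately show ?thesis by (subst DERIV_cong_ev[OF refl _ refl])
  qed
  have D4: "((\<lambda>s. rcoef (volterra_inv g (c s)) 0) has_field_derivative rcoef (X1 n) 0) (at t)"
  proof -
    have *: "rcoef (X1 n) 0 = 0"
      using Mspace_coef[OF m(1)] unfolding X V(3) pn by (simp add: qn0)
    have "((\<lambda>s. 0) has_field_derivative rcoef (X1 n) 0) (at t)"
      unfolding * by (rule DERIV_const)
    moreover have "\<forall>\<^sub>F s in nhds t. rcoef (volterra_inv g (c s)) 0 = 0"
      using at_t by eventually_elim (rule volterra_inv_coef(3), auto)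
    ultimately show ?thesis by (subst DERIV_cong_ev[OF refl _ refl])
  qed
  have "((\<lambda>s. rcoef (volterra_inv g (c s)) i) has_field_derivative rcoef (X1 n) i) (at t)" for i
    using D3 D4 by (cases i) auto
  then show "has_triplet_derivative (\<lambda>s. volterra_inv g (c s)) (X1 (volterra_inv g (c t))) t"
    using D1 D2 by (simp add: has_triplet_derivative_def n_def m_def)
qed

interpretation forward: flow_symmetry g volterra_w volterra "{m \<in> Mspace g. volterra_w m \<noteq> 0}" for g
  by (rule flow_symmetry_volterra) simp

interpretation backward: flow_symmetry g "\<lambda>m. rcoef m 1" "volterra_inv g"
  "{m \<in> Mspace g. rcoef m 1 \<noteq> 0}" for g
  by (rule flow_symmetry_volterra_inv) simp


section \<open>The Volterra lattice\<close>

lemma generically_conj: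
  assumes "generically g A" "generically g B"
  shows "generically g (\<lambda>m. A m \<and> B m)"
proof -
  obtain F where F: "countable F" "F \<subseteq> regular_fun" "\<forall>f\<in>F. \<exists>m\<in>Mspace g. f m \<noteq> 0"
    "\<forall>m\<in>Mspace g. (\<forall>f\<in>F. f m \<noteq> 0) \<longrightarrow> A m"
    using assms(1) unfolding generically_def by blast
  obtain F' where F': "countable F'" "F' \<subseteq> regular_fun" "\<forall>f\<in>F'. \<exists>m\<in>Mspace g. f m \<noteq> 0"
    "\<forall>m\<in>Mspace g. (\<forall>f\<in>F'. f m \<noteq> 0) \<longrightarrow> B m"
    using assms(2) unfolding generically_def by blast
  show ?thesis
    unfolding generically_def
  proof (intro exI conjI)
    show "countable (F \<union> F')" "F \<union> F' \<subseteq> regular_fun" "\<forall>f\<in>F \<union> F'. \<exists>m\<in>Mspace g. f m \<noteq> 0"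
      using F F' by auto
    show "\<forall>m\<in>Mspace g. (\<forall>f\<in>F \<union> F'. f m \<noteq> 0) \<longrightarrow> A m \<and> B m"
      using F(4) F'(4) by blast
  qed
qed

text \<open>Here w = 1, Q - P = 1, the quotient of - 2 x by - x is 2, and - x Q = - 2 x. The degrees
  are low enough for every \<open>g\<close>.\<close>

lemma volterra_fixed_point:
  defines "m0 \<equiv> ([:1:], [:2:], [:0, - 2:])"
  shows "m0 \<in> Mspace g" "volterra_w m0 = 1" "volterra m0 = m0"
proof -
  show "m0 \<in> Mspace g" and w: "volterra_w m0 = 1" by (auto simp: m0_def Mspace_def)
  have "poly_shift 1 [:0, - 2 :: complex:] = [:- 2:]"
    by (rule poly_eqI) (simp add: coeff_poly_shift coeff_pCons split: nat.splits)
  then show "volterra m0 = m0"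
    using volterra_eq[of "[:1:]" "[:2:]" "[:0, - 2:]" 1] w by (simp add: m0_def)
qed

text \<open>The same point is fixed by the inverse, and its r_1 is - 2, so it serves as witness in
  both directions.\<close>

lemma generically_all_iterates_exist: "generically g (all_iterates_exist g)"
proof -
  define m0 :: triplet where "m0 = ([:1:], [:2:], [:0, - 2:])"
  note fp = volterra_fixed_point[folded m0_def]
  have dom: "m0 \<in> volterra_domain g"
    using fp by (simp add: volterra_domain_def)
  have "volterra_inv g m0 = m0"
    using volterra_inv_volterra[OF dom] fp by simp
  then have "generically g (\<lambda>m. (\<forall>k. (volterra ^^ k) m \<in> {m \<in> Mspace g. volterra_w m \<noteq> 0}) \<and>
      (\<forall>k. (volterra_inv g ^^ k) m \<in> {m \<in> Mspace g. rcoef m 1 \<noteq> 0}))"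
    using fp rcoef_1_volterra[OF dom]
    by (intro generically_conj forward.generically_iterates[of m0] backward.generically_iterates[of m0]) simp_all
  then show ?thesis
    unfolding all_iterates_exist_def[abs_def] volterra_image by (simp add: volterra_domain_def)
qed

section \<open>Iterates of an integral curve\<close>

lemma flow_curve_integral_curve:
  assumes "meromorphic_integral_curve g c" "has_initial_condition c m"
  shows "flow_curve g c"
proof -
  have "(\<lambda>t. f (c t)) meromorphic_on UNIV \<and> isCont (\<lambda>t. f (c t)) 0" if "f \<in> coords" for f
    using that assms
    by (auto simp: coords_def meromorphic_integral_curve_def meromorphic_curve_def
        has_initial_condition_def intro: analytic_at_imp_isCont)
  then show ?thesis
    using assms by (auto simp: flow_curve_def meromorphic_integral_curve_def meromorphic_curve_def)
qed

text \<open>Existence of the iterates at time 0 alone suffices: each application of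
  \<open>flow_curve_map\<close> asks only for the value at 0 to lie in the domain.\<close>

lemma flow_curve_iterates:
  assumes c: "flow_curve g c" and ex: "all_iterates_exist g (c 0)"
  shows "flow_curve g (\<lambda>t. (volterra ^^ k) (c t))" "flow_curve g (\<lambda>t. (volterra_inv g ^^ k) (c t))"
proof -
  show "flow_curve g (\<lambda>t. (volterra ^^ k) (c t))"
  proof (induction k)
    case (Suc k)
    then have "flow_curve g (\<lambda>t. volterra ((volterra ^^ k) (c t)))"
      by (rule forward.flow_curve_map)
        (use ex in \<open>auto simp: all_iterates_exist_def volterra_domain_def\<close>)
    then show ?case by simp
  qed (simp add: c)
  show "flow_curve g (\<lambda>t. (volterra_inv g ^^ k) (c t))"
  proof (induction k)
    case (Suc k)
    then have "flow_curve g (\<lambda>t. volterra_inv g ((volterra_inv g ^^ k) (c t)))"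
      by (rule backward.flow_curve_map)
        (use ex in \<open>auto simp: all_iterates_exist_def volterra_image\<close>)
    then show ?case by simp
  qed (simp add: c)
qed

lemma flow_curve_volterra_iter:
  assumes "flow_curve g c" "all_iterates_exist g (c 0)"
  shows "flow_curve g (\<lambda>t. volterra_iter g n (c t))"
  using flow_curve_iterates[OF assms] by (cases "n \<ge> 0") (simp_all add: volterra_iter_def)

text \<open>The recursion changes form with the sign of the index. For negative \<open>n\<close> the
  map has to undo its inverse, which the assumptions on the later iterate permit.\<close>

lemma volterra_iter_succ:
  assumes "volterra_iter g (n + 1) m \<in> Mspace g" "rcoef (volterra_iter g (n + 1) m) 1 \<noteq> 0"
  shows "volterra_iter g (n + 1) m = volterra (volterra_iter g n m)"
proof (cases "n \<ge> 0")
  case True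
  then show ?thesis by (simp add: volterra_iter_def nat_add_distrib)
next
  case False
  define k where "k = nat (- n - 1)"
  have "volterra_iter g (n + 1) m = (volterra_inv g ^^ k) m"
    using False by (cases "n = - 1") (auto simp: volterra_iter_def k_def)
  moreover have "nat (- n) = Suc k" using False by (simp add: k_def)
  then have "volterra_iter g n m = volterra_inv g ((volterra_inv g ^^ k) m)"
    using False by (simp add: volterra_iter_def)
  ultimately show ?thesis using volterra_volterra_inv[OF assms] by simp
qed

lemma volterra_iter_pred:
  assumes "volterra_iter g (n - 1) m \<in> volterra_domain g"
  shows "volterra_iter g (n - 1) m = volterra_inv g (volterra_iter g n m)"
proof (cases "n \<le> 0")
  case True
  define k where "k = nat (- n)"
  have "volterra_iter g n m = (volterra_inv g ^^ k) m"
    using True by (cases "n = 0") (auto simp: volterra_iter_def k_def)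
  moreover have "nat (- (n - 1)) = Suc k" using True by (simp add: k_def)
  then have "volterra_iter g (n - 1) m = volterra_inv g ((volterra_inv g ^^ k) m)"
    using True by (simp add: volterra_iter_def)
  ultimately show ?thesis by simp
next
  case False
  then have "nat n = Suc (nat (n - 1))" by simp
  then have "volterra_iter g n m = volterra (volterra_iter g (n - 1) m)"
    using False by (simp add: volterra_iter_def)
  then show ?thesis using volterra_inv_volterra[OF assms] by simp
qed

lemma volterra_iter_in_domains:
  assumes "all_iterates_exist g m"
  shows "volterra_iter g n m \<in> {m \<in> Mspace g. volterra_w m \<noteq> 0}"
    and "volterra_iter g n m \<in> {m \<in> Mspace g. rcoef m 1 \<noteq> 0}"
proof -
  have fw: "(volterra ^^ k) m \<in> volterra_domain g"
    and bw: "(volterra_inv g ^^ k) m \<in> {m \<in> Mspace g. rcoef m 1 \<noteq> 0}" for k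
    using assms unfolding all_iterates_exist_def volterra_image by blast+
  have fw': "(volterra ^^ Suc k) m \<in> {m \<in> Mspace g. rcoef m 1 \<noteq> 0}" for k
    using fw[of k] volterra_image[of g] by auto
  have bw': "(volterra_inv g ^^ Suc k) m \<in> volterra_domain g" for k
    using bw[of k] volterra_inv_in_domain by simp
  have "volterra_iter g n m \<in> volterra_domain g"
  proof (cases "n \<ge> 0")
    case True
    then show ?thesis using fw by (simp add: volterra_iter_def)
  next
    case False
    then show ?thesis using bw'[of "nat (- n) - 1"] by (simp add: volterra_iter_def)
  qed
  then show "volterra_iter g n m \<in> {m \<in> Mspace g. volterra_w m \<noteq> 0}"
    by (simp add: volterra_domain_def)
  show "volterra_iter g n m \<in> {m \<in> Mspace g. rcoef m 1 \<noteq> 0}"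
  \<comment> \<open>A positive iterate is an image under the map. Index 0 is grouped with the
    negative ones, where the condition on the inverse iterates applies.\<close>
  proof (cases "n > 0")
    case True
    then show ?thesis using fw'[of "nat n - 1"] by (simp add: volterra_iter_def)
  next
    case False
    then show ?thesis using bw[of "nat (- n)"] by (cases "n = 0") (auto simp: volterra_iter_def)
  qed
qed

section \<open>The lattice equation\<close>

text \<open>Off a sparse set all three consecutive iterates lie in the required domains, so both
  neighbours of w_n are functions of \<open>m\<close>. The r_2 in the derivative of r_1 matches the
  one contributed by w_{n-1}.\<close>

lemma flow_curve_volterra_lattice:
  assumes c: "flow_curve g c" and ex: "all_iterates_exist g (c 0)"
  shows "wseq g c n meromorphic_on UNIV"
    and "\<forall>\<^sub>\<approx>t\<in>UNIV. (wseq g c n has_field_derivative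
           wseq g c n t * (wseq g c (n + 1) t - wseq g c (n - 1) t)) (at t)"
proof -
  let ?c = "\<lambda>k t. volterra_iter g k (c t)"
  have flow: "flow_curve g (?c k)" for k
    by (rule flow_curve_volterra_iter[OF c ex])
  have "(\<lambda>t. rcoef (?c n t) 1) meromorphic_on UNIV"
    using flow by (rule flow_curve_regular(1)) (rule regular_fun.r)
  then show "wseq g c n meromorphic_on UNIV"
    unfolding wseq_def[abs_def] by (intro meromorphic_intros) simp_all
  have fw: "\<forall>\<^sub>\<approx>t\<in>UNIV. ?c k t \<in> {m \<in> Mspace g. volterra_w m \<noteq> 0}"
    and bw: "\<forall>\<^sub>\<approx>t\<in>UNIV. ?c k t \<in> {m \<in> Mspace g. rcoef m 1 \<noteq> 0}" for k
    using forward.flow_curve_in_domain(1)[OF flow] backward.flow_curve_in_domain(1)[OF flow]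
      volterra_iter_in_domains[OF ex] by blast+
  have D: "\<forall>\<^sub>\<approx>t\<in>UNIV. has_triplet_derivative (?c n) (X1 (?c n t)) t"
    using flow[of n] by (auto simp: flow_curve_def elim: eventually_mono)
  have "\<forall>\<^sub>\<approx>t\<in>UNIV. ?c n t \<in> volterra_domain g \<and> ?c (n - 1) t \<in> volterra_domain g \<and>
      rcoef (?c n t) 1 \<noteq> 0 \<and> ?c (n + 1) t \<in> Mspace g \<and> rcoef (?c (n + 1) t) 1 \<noteq> 0 \<and>
      has_triplet_derivative (?c n) (X1 (?c n t)) t"
    using fw[of n] fw[of "n - 1"] bw[of n] bw[of "n + 1"] D
    by eventually_elim (simp add: volterra_domain_def)
  then show "\<forall>\<^sub>\<approx>t\<in>UNIV. (wseq g c n has_field_derivative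
           wseq g c n t * (wseq g c (n + 1) t - wseq g c (n - 1) t)) (at t)"
  proof eventually_elim
    case (elim t)
    define m where "m = ?c n t"
    have m: "m \<in> volterra_domain g" "m \<in> Mspace g" "rcoef m 1 \<noteq> 0"
      using elim by (auto simp: m_def volterra_domain_def)
    have w: "wseq g c n t = - rcoef m 1 / 2"
      by (simp add: wseq_def m_def)
    have w_succ: "wseq g c (n + 1) t = volterra_w m"
      using volterra_iter_succ[of g n "c t"] elim rcoef_1_volterra[OF m(1)]
      by (simp add: wseq_def m_def)
    \<comment> \<open>This is the inverse formula for R at \<open>i\<close> = 0; the summand
      \<open>rcoef m 1\<close> arises from q_0 = 2.\<close>
    have w_pred: "wseq g c (n - 1) t = - (2 * pcoef m 1 + rcoef m 1 - 2 * rcoef m 2 / rcoef m 1) / 2"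
      using volterra_iter_pred[of g n "c t"] elim volterra_inv_coef(4)[OF m(2,3), of 0] Mspace_coef(2)[OF m(2)]
      by (simp add: wseq_def m_def numeral_2_eq_2)
    have "((\<lambda>s. rcoef (?c n s) 1) has_field_derivative rcoef (X1 m) 1) (at t)"
      using elim by (simp add: has_triplet_derivative_def m_def)
    then have "(wseq g c n has_field_derivative - rcoef (X1 m) 1 / 2) (at t)"
      unfolding wseq_def[abs_def] by (auto intro!: derivative_eq_intros)
    also have "- rcoef (X1 m) 1 / 2 = wseq g c n t * (wseq g c (n + 1) t - wseq g c (n - 1) t)"
      unfolding w w_succ w_pred X1_coef volterra_w_coef
      using m(3) by (simp add: field_simps numeral_2_eq_2)
    finally show ?case .
  qed
qed

theorem theorem5p3:
  fixes g :: nat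
  assumes "g \<ge> 1"
  shows "generically g (all_iterates_exist g) \<and>
         (\<forall>m c. m \<in> Mspace g \<and> all_iterates_exist g m \<and>
                meromorphic_integral_curve g c \<and> has_initial_condition c m \<longrightarrow>
                (\<forall>n::int. wseq g c n meromorphic_on UNIV \<and>
                   (\<forall>\<^sub>\<approx>t\<in>UNIV. (wseq g c n has_field_derivative
                      wseq g c n t * (wseq g c (n + 1) t - wseq g c (n - 1) t)) (at t))))"
proof (intro conjI allI impI)
  show "generically g (all_iterates_exist g)" by (rule generically_all_iterates_exist)
next
  fix m c n
  assume *: "m \<in> Mspace g \<and> all_iterates_exist g m \<and>
    meromorphic_integral_curve g c \<and> has_initial_condition c m"
  then have "flow_curve g c" "all_iterates_exist g (c 0)"
    using flow_curve_integral_curve by (auto simp: has_initial_condition_def)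
  then show "wseq g c n meromorphic_on UNIV"
    and "\<forall>\<^sub>\<approx>t\<in>UNIV. (wseq g c n has_field_derivative
           wseq g c n t * (wseq g c (n + 1) t - wseq g c (n - 1) t)) (at t)"
    by (rule flow_curve_volterra_lattice)+
qed

end
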